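(* For every fixed positive integer $m$, as $n\to\infty$, $$\alpha(m,n)=\Theta\!\left(\frac{\alpha(m,1)^n}{n^{\lfloor\frac{m-1}{2}\rfloor+\frac12}}\right),$$ that is, there exist constants $0<c_1\le c_2$ depending only on $m$ such that $c_1\frac{\alpha(m,1)^n}{n^{\lfloor (m-1)/2\rfloor+1/2}}\le \alpha(m,n)\le c_2\frac{\alpha(m,1)^n}{n^{\lfloor (m-1)/2\rfloor+1/2}}$ for all sufficiently large $n$. Here $\alpha(2t-1,1)=\alpha(2t,1)=\binom{2t}{t}$ for every positive integer $t$.
   Context: For positive integers $m,n$, let $A(m,n)$ be the set of all $m\times n$ matrices with every entry in $\{1,-1\}$ such that every row sum and every column sum has absolute value at most $1$, and let $\alpha(m,n)=|A(m,n)|$. *)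

theory Defs
  imports Complex_Main "HOL-Library.Landau_Symbols" "Jordan_Normal_Form.Matrix"
begin

definition A :: "nat \<Rightarrow> nat \<Rightarrow> int mat set" where
  "A m n = {M \<in> carrier_mat m n.
     (\<forall>i<m. \<forall>j<n. M $$ (i, j) \<in> {1, -1}) \<and>
     (\<forall>i<m. \<bar>\<Sum>j<n. M $$ (i, j)\<bar> \<le> 1) \<and>
     (\<forall>j<n. \<bar>\<Sum>i<m. M $$ (i, j)\<bar> \<le> 1)}"

definition alpha :: "nat \<Rightarrow> nat \<Rightarrow> nat" where
  "alpha m n = card (A m n)"

text \<open>\<^const>\<open>card\<close> sends infinite sets to \<open>0\<close>; this does not happen here.\<close>

lemma finite_A: "finite (A m n)"
proof -
  let ?F = "({..<m} \<times> {..<n}) \<rightarrow>\<^sub>E {1, -1 :: int}"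
  have "A m n \<subseteq> mat m n ` ?F"
  proof
    fix M assume M: "M \<in> A m n"
    let ?f = "restrict (($$) M) ({..<m} \<times> {..<n})"
    have "?f \<in> ?F" using M by (auto simp: A_def)
    moreover have "M = mat m n ?f" using M by (intro eq_matI) (auto simp: A_def)
    ultimately show "M \<in> mat m n ` ?F" by blast
  qed
  moreover have "finite ?F" by (intro finite_PiE) auto
  ultimately show ?thesis by (meson finite_imageI finite_subset)
qed

end

(* Adding one more row to an odd number of rows makes all column sums vanish, so for m = 2t - 1
   and m = 2t alike a matrix is a walk of n steps chosen among the t-element subsets of the 2t rows,
   and the walk is determined by its first d = 2t - 1 coordinates.

   Upper bound: exchanging the roles of row l and of the last row in a step that separates them
   only moves coordinate l (and the last one) of the walk.  Averaging over these exchanges in a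
   block of k steps spreads coordinate l binomially, which gains a factor O(1 / sqrt k) and leaves
   the other coordinates alone.  One block for each of the d coordinates gives O(n^(-d/2)) for the
   probability of ending at any given point.

   Lower bound: by complementation symmetry the number of closed walks of length 2k is the sum of
   the squares of the numbers of walks of length k to each endpoint.  By Chebyshev half of these
   walks end in a box with O(k^(d/2)) points, and Cauchy-Schwarz applies.  For odd n any further
   step keeps all row sums within 1. *)
theory Submission imports Defs "HOL-Analysis.Convex"
begin

section \<open>Balanced columns as steps of a walk\<close>

definition sg :: "nat set \<Rightarrow> nat \<Rightarrow> int" where
  "sg S i = (if i \<in> S then 1 else -1)"

text \<open>A set encodes the column of height \<open>2 * t\<close> with entry \<open>1\<close>
  exactly in the rows it contains, as read off by \<open>sg\<close>; having \<open>t\<close>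
  elements means that the column sum is zero.\<close>

definition halves :: "nat \<Rightarrow> nat set set" where
  "halves t = {S. S \<subseteq> {..<2 * t} \<and> card S = t}"

definition walks :: "nat \<Rightarrow> nat \<Rightarrow> nat set list set" where
  "walks t n = {xs. set xs \<subseteq> halves t \<and> length xs = n}"

definition disp :: "nat set list \<Rightarrow> nat \<Rightarrow> int" where
  "disp xs i = (\<Sum>S\<leftarrow>xs. sg S i)"

text \<open>Prescribing only the first \<open>l\<close> coordinates lets the upper bound proceed by
  induction on \<open>l\<close>, one coordinate at a time.\<close>

definition hits :: "nat \<Rightarrow> nat \<Rightarrow> nat \<Rightarrow> (nat \<Rightarrow> int) \<Rightarrow> real" where
  "hits t l n s = (\<Sum>xs\<in>walks t n. of_bool (\<forall>i<l. disp xs i = s i))"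

lemma disp_simps [simp]:
  "disp [] i = 0" "disp (S # xs) i = sg S i + disp xs i" "disp (xs @ ys) i = disp xs i + disp ys i"
  by (simp_all add: disp_def)

lemma finite_halves [simp]: "finite (halves t)"
  by (rule finite_subset[of _ "Pow {..<2 * t}"]) (auto simp: halves_def)

lemma card_halves: "card (halves t) = (2 * t) choose t"
  unfolding halves_def by (subst n_subsets) auto

lemma finite_walks [simp]: "finite (walks t n)"
  unfolding walks_def by (rule finite_lists_length_eq) simp

lemma card_walks: "card (walks t n) = card (halves t) ^ n"
  unfolding walks_def by (rule card_lists_length_eq) simp

lemma walks_0 [simp]: "walks t 0 = {[]}"
  by (auto simp: walks_def)

lemma sum_walks_Suc:
  "(\<Sum>xs\<in>walks t (Suc n). f xs) = (\<Sum>S\<in>halves t. \<Sum>xs\<in>walks t n. f (S # xs))"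
proof -
  have "walks t (Suc n) = (\<lambda>(S, xs). S # xs) ` (halves t \<times> walks t n)"
    by (auto simp: walks_def length_Suc_conv)
  then show ?thesis
    by (simp add: sum.cartesian_product sum.reindex inj_on_def case_prod_unfold)
qed

lemma sum_walks_add:
  "(\<Sum>xs\<in>walks t (a + b). f xs) = (\<Sum>ys\<in>walks t a. \<Sum>zs\<in>walks t b. f (ys @ zs))"
  by (induction a arbitrary: f) (simp_all add: sum_walks_Suc)

lemma sum_sg:
  assumes "S \<in> halves t"
  shows "(\<Sum>i<2 * t. sg S i) = 0"
proof -
  have S: "S \<subseteq> {..<2 * t}" "card S = t" "finite S"
    using assms by (auto simp: halves_def intro: finite_subset)
  have "(\<Sum>i<2 * t. sg S i) = (\<Sum>i<2 * t. 2 * of_bool (i \<in> S) - 1)"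
    by (intro sum.cong) (auto simp: sg_def)
  also have "\<dots> = 2 * int (card ({..<2 * t} \<inter> S)) - 2 * int t"
    by (simp add: sum_subtractf flip: sum_distrib_left)
  also have "{..<2 * t} \<inter> S = S" using S by blast
  finally show ?thesis using S by simp
qed

lemma sum_disp:
  assumes "xs \<in> walks t n"
  shows "(\<Sum>i<2 * t. disp xs i) = 0"
proof -
  have "set xs \<subseteq> halves t \<Longrightarrow> (\<Sum>i<2 * t. disp xs i) = 0"
    by (induction xs) (simp_all add: sum.distrib sum_sg)
  then show ?thesis using assms by (simp add: walks_def)
qed

subsection \<open>Matrices as walks\<close>

text \<open>For even \<open>m\<close> the column sums are even, so the bound 1 forces them to
  vanish; for odd \<open>m\<close> the added row absorbs a column sum of 1 or -1. Only rows below
  \<open>m\<close> carry the row condition, so the added row is left free.\<close>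

lemma alpha_eq_card_walks:
  assumes "0 < t" and m: "m = 2 * t \<or> m = 2 * t - 1"
  shows "alpha m n = card {xs \<in> walks t n. \<forall>i<m. \<bar>disp xs i\<bar> \<le> 1}"
proof -
  let ?W = "{xs \<in> walks t n. \<forall>i<m. \<bar>disp xs i\<bar> \<le> 1}"
  let ?f = "\<lambda>xs. mat m n (\<lambda>(i, j). sg (xs ! j) i)"
  have row: "(\<Sum>j<n. sg (xs ! j) i) = disp xs i" if "length xs = n" for xs i
    unfolding disp_def using that by (simp add: sum_list_sum_nth atLeast0LessThan)
  \<comment> \<open>For odd \<open>m\<close> the partial sum is the negative of the single entry in
    the added row.\<close>
  have col: "\<bar>\<Sum>i<m. sg S i\<bar> \<le> 1" if "S \<in> halves t" for S
  proof (cases "m = 2 * t")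
    case False
    then have "2 * t = Suc m" using m \<open>0 < t\<close> by auto
    then have "(\<Sum>i<m. sg S i) + sg S m = 0" using sum_sg[OF that] by simp
    then show ?thesis by (auto simp: sg_def split: if_splits)
  qed (use sum_sg[OF that] in simp)
  \<comment> \<open>The zero sum recovers the entry in the added row from the other rows; this gives
    injectivity.\<close>
  have determined: "S = S'" if SS: "S \<in> halves t" "S' \<in> halves t" and eq: "\<And>i. i < m \<Longrightarrow> sg S i = sg S' i" for S S'
  proof -
    have mem: "i \<in> S \<longleftrightarrow> i \<in> S'" if "i < m" for i
      using eq[OF that] by (auto simp: sg_def split: if_splits)
    have "i \<in> S \<longleftrightarrow> i \<in> S'" if i: "i < 2 * t" for i
    proof (cases "i < m")
      case False
      with i m have im: "i = m" "2 * t = Suc m" by auto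
      have "(\<Sum>i<m. sg S i) = (\<Sum>i<m. sg S' i)" using eq by simp
      then have "sg S m = sg S' m" using sum_sg[OF SS(1)] sum_sg[OF SS(2)] im by simp
      then show ?thesis using im by (auto simp: sg_def split: if_splits)
    qed (rule mem)
    then show ?thesis using SS by (auto simp: halves_def)
  qed
  have "inj_on ?f ?W"
  proof (rule inj_onI)
    fix xs ys assume xy: "xs \<in> ?W" "ys \<in> ?W" and eq: "?f xs = ?f ys"
    have len: "length xs = n" "length ys = n" using xy by (auto simp: walks_def)
    have "sg (xs ! j) i = sg (ys ! j) i" if "i < m" "j < n" for i j
      using arg_cong[OF eq, of "\<lambda>M. M $$ (i, j)"] that by simp
    moreover have "xs ! j \<in> halves t" "ys ! j \<in> halves t" if "j < n" for j
      using xy that by (auto simp: walks_def)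
    ultimately show "xs = ys" using len determined by (intro nth_equalityI) auto
  qed
  moreover have "?f ` ?W = A m n"
  proof (intro equalityI subsetI)
    fix M assume "M \<in> ?f ` ?W"
    then obtain xs where xs: "xs \<in> ?W" "M = ?f xs" by blast
    then have "length xs = n" "\<And>j. j < n \<Longrightarrow> xs ! j \<in> halves t" by (auto simp: walks_def)
    then show "M \<in> A m n" using xs col row by (auto simp: A_def sg_def)
  next
    fix M assume M: "M \<in> A m n"
    define P where "P j = {i. i < m \<and> M $$ (i, j) = 1}" for j
    \<comment> \<open>\<open>P j\<close> has \<open>t\<close> elements, or \<open>t - 1\<close> if
      \<open>m\<close> is odd and the column sum is -1; in the latter case the added row, of index
      \<open>2 * t - 1\<close>, receives the entry \<open>1\<close>.\<close>
    define X where "X j = P j \<union> (if card (P j) < t then {2 * t - 1} else {})" for j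
    define xs where "xs = map X [0..<n]"
    have X: "X j \<in> halves t \<and> (\<forall>i<m. sg (X j) i = M $$ (i, j))" if j: "j < n" for j
    proof -
      have e: "M $$ (i, j) = 2 * of_bool (i \<in> P j) - 1" if "i < m" for i
        using M that j by (auto simp: A_def P_def)
      have "(\<Sum>i<m. M $$ (i, j)) = (\<Sum>i<m. 2 * of_bool (i \<in> P j) - 1)"
        using e by simp
      also have "\<dots> = 2 * int (card ({..<m} \<inter> P j)) - int m"
        by (simp add: sum_subtractf flip: sum_distrib_left)
      also have "{..<m} \<inter> P j = P j" by (auto simp: P_def)
      finally have c: "\<bar>2 * int (card (P j)) - int m\<bar> \<le> 1"
        using M j by (auto simp: A_def)
      have sub: "P j \<subseteq> {..<m}" "finite (P j)" by (auto simp: P_def)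
      show ?thesis
      proof (cases "card (P j) < t")
        case True
        with c m have m1: "m = 2 * t - 1" "card (P j) = t - 1" by auto
        then have notin: "2 * t - 1 \<notin> P j" by (auto simp: P_def)
        have "X j \<in> halves t"
          using True m1 sub notin \<open>0 < t\<close> by (auto simp: halves_def X_def)
        moreover have "sg (X j) i = M $$ (i, j)" if "i < m" for i
          using e[OF that] that m1 True by (auto simp: sg_def X_def)
        ultimately show ?thesis by blast
      next
        case False
        with c m have "card (P j) = t" by auto
        then show ?thesis using e sub m by (auto simp: halves_def X_def sg_def)
      qed
    qed
    have "M = ?f xs" using M X by (intro eq_matI) (auto simp: A_def xs_def)
    moreover have "xs \<in> walks t n" using X by (auto simp: walks_def xs_def)
    moreover have "disp xs i = (\<Sum>j<n. M $$ (i, j))" if "i < m" for i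
    proof -
      have "disp xs i = (\<Sum>j<n. sg (xs ! j) i)" by (rule row[symmetric]) (simp add: xs_def)
      also have "\<dots> = (\<Sum>j<n. M $$ (i, j))" using X that by (simp add: xs_def)
      finally show ?thesis .
    qed
    ultimately show "M \<in> ?f ` ?W" using M by (auto simp: A_def)
  qed
  ultimately show ?thesis unfolding alpha_def using card_image[of ?f ?W] by simp
qed

text \<open>After a single step every coordinate is 1 or -1, so all walks of length one
  qualify.\<close>

lemma alpha_1:
  assumes "0 < t" and "m = 2 * t \<or> m = 2 * t - 1"
  shows "alpha m 1 = (2 * t) choose t"
proof -
  have "{xs \<in> walks t 1. \<forall>i<m. \<bar>disp xs i\<bar> \<le> 1} = walks t 1"
    by (auto simp: walks_def length_Suc_conv sg_def)
  then show ?thesis using alpha_eq_card_walks[OF assms, of 1] by (simp add: card_walks card_halves)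
qed

subsection \<open>The upper bound\<close>

lemma hits_nonneg: "0 \<le> hits t l n s"
  unfolding hits_def by (intro sum_nonneg) simp

lemma hits_cong:
  assumes "\<And>i. i < l \<Longrightarrow> s i = s' i"
  shows "hits t l n s = hits t l n s'"
  unfolding hits_def using assms by (intro sum.cong) auto

lemma hits_no_coordinates: "hits t 0 n s = card (halves t) ^ n"
  by (simp add: hits_def card_walks)

lemma hits_Suc: "hits t l (Suc n) s = (\<Sum>S\<in>halves t. hits t l n (\<lambda>i. s i - sg S i))"
  unfolding hits_def sum_walks_Suc by (intro sum.cong refl) (auto simp: algebra_simps)

text \<open>A walk has only one value in coordinate \<open>l\<close>, so it is counted for at most
  one \<open>b\<close>.\<close>

lemma sum_hits_slices_le:
  assumes "finite B"
  shows "(\<Sum>b\<in>B. hits t (Suc l) n (s(l := b))) \<le> hits t l n s"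
proof -
  have "(\<Sum>b\<in>B. hits t (Suc l) n (s(l := b)))
      = (\<Sum>xs\<in>walks t n. \<Sum>b\<in>B. of_bool (\<forall>i<Suc l. disp xs i = (s(l := b)) i))"
    unfolding hits_def by (rule sum.swap)
  also have "\<dots> \<le> hits t l n s"
    unfolding hits_def
  proof (intro sum_mono)
    fix xs
    have "(\<Sum>b\<in>B. of_bool (\<forall>i<Suc l. disp xs i = (s(l := b)) i))
        = (\<Sum>b\<in>B. if b = disp xs l then of_bool (\<forall>i<l. disp xs i = s i) else (0 :: real))"
      by (intro sum.cong) (auto simp: less_Suc_eq)
    also have "\<dots> \<le> of_bool (\<forall>i<l. disp xs i = s i)"
      using assms by (simp add: sum.delta)
    finally show "(\<Sum>b\<in>B. of_bool (\<forall>i<Suc l. disp xs i = (s(l := b)) i))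
      \<le> (of_bool (\<forall>i<l. disp xs i = s i) :: real)" .
  qed
  finally show ?thesis .
qed

text \<open>The binomial average of \<open>F\<close> produced by \<open>j\<close> free exchanges of row \<open>l\<close> with the
  last row, up to the factor \<open>2 ^ j\<close>.\<close>

definition smear :: "nat \<Rightarrow> nat \<Rightarrow> ((nat \<Rightarrow> int) \<Rightarrow> real) \<Rightarrow> (nat \<Rightarrow> int) \<Rightarrow> real" where
  "smear l j F s = (\<Sum>b\<le>j. real (j choose b) * F (s(l := s l - 2 * int b)))"

lemma sum_choose_Suc:
  fixes g :: "nat \<Rightarrow> real"
  shows "(\<Sum>b\<le>Suc j. real (Suc j choose b) * g b)
    = (\<Sum>b\<le>j. real (j choose b) * g b) + (\<Sum>b\<le>j. real (j choose b) * g (Suc b))"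
proof -
  have "(\<Sum>b\<le>j. real (j choose b) * g b) = (\<Sum>b\<le>Suc j. real (j choose b) * g b)"
    by simp
  also have "\<dots> = g 0 + (\<Sum>b\<le>j. real (j choose Suc b) * g (Suc b))"
    by (subst sum.atMost_Suc_shift) simp
  finally show ?thesis
    by (subst sum.atMost_Suc_shift) (simp add: sum.distrib algebra_simps)
qed

text \<open>Pascal's rule: one more exchange is either left out or made, and making it turns a -1 in
  row \<open>l\<close> into 1, a change of 2.\<close>

lemma smear_Suc: "smear l (Suc j) F s = smear l j F s + smear l j F (s(l := s l - 2))"
  unfolding smear_def sum_choose_Suc by (simp add: algebra_simps)

text \<open>An exchange also changes the last coordinate; this allows that change to be ignored,
  since \<open>hits\<close> reads only coordinates below \<open>l'\<close>.\<close>

lemma smear_hits_cong: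
  assumes "\<And>i. i < l' \<Longrightarrow> s i = s' i" and "l < l'"
  shows "smear l j (hits t l' n) s = smear l j (hits t l' n) s'"
proof -
  have "hits t l' n (s(l := s l - 2 * int b)) = hits t l' n (s'(l := s' l - 2 * int b))" for b
    using assms by (intro hits_cong) auto
  then show ?thesis by (simp add: smear_def)
qed

lemma smear_hits_Suc:
  "smear l j (hits t l' (Suc n)) s = (\<Sum>S\<in>halves t. smear l j (hits t l' n) (\<lambda>i. s i - sg S i))"
proof -
  have "(\<lambda>i. (s(l := s l - 2 * int b)) i - sg S i)
      = (\<lambda>i. s i - sg S i)(l := s l - sg S l - 2 * int b)" for b S
    by auto
  then show ?thesis
    unfolding smear_def hits_Suc sum_distrib_left by (subst sum.swap) simp
qed

section \<open>Bounds for binomial coefficients and inverse square roots\<close>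

lemma Suc_times_central_binomial:
  "Suc n * ((2 * Suc n) choose Suc n) = 2 * (2 * n + 1) * ((2 * n) choose n)"
proof -
  have "Suc n * ((2 * Suc n) choose Suc n) = (2 * n + 2) * ((2 * n + 1) choose n)"
    using Suc_times_binomial_eq[of "2 * n + 1" n] by (simp add: mult.commute)
  moreover have "(2 * n + 1) choose n = (2 * n + 1) choose Suc n"
    using binomial_symmetric[of n "2 * n + 1"] by simp
  moreover have "Suc n * ((2 * n + 1) choose Suc n) = (2 * n + 1) * ((2 * n) choose n)"
    using Suc_times_binomial_eq[of "2 * n" n] by (simp add: mult.commute)
  ultimately show ?thesis by (simp only:) (simp add: mult.assoc)
qed

text \<open>The factor \<open>2 * real n + 1\<close> makes the induction close: by the recurrence
  the left side is multiplied by 4 (2n + 1)(2n + 3) / (n + 1)^2 at each step, which is at most the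
  factor 16 gained on the right.\<close>

lemma central_binomial_sq_le: "real ((2 * n) choose n) ^ 2 * (2 * real n + 1) \<le> (4 ^ n)\<^sup>2"
proof (induction n)
  case (Suc n)
  let ?c = "real ((2 * n) choose n)" and ?d = "real ((2 * Suc n) choose Suc n)"
  have "real (Suc n * ((2 * Suc n) choose Suc n)) = real (2 * (2 * n + 1) * ((2 * n) choose n))"
    by (simp only: Suc_times_central_binomial)
  then have "(real n + 1) * ?d = 2 * (2 * real n + 1) * ?c"
    by (simp only: of_nat_mult of_nat_add of_nat_Suc of_nat_numeral of_nat_1 add.commute)
  then have "((real n + 1) * ?d)\<^sup>2 = (2 * (2 * real n + 1) * ?c)\<^sup>2"
    by (simp only:)
  then have "(real n + 1)\<^sup>2 * (?d\<^sup>2 * (2 * real (Suc n) + 1))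
      = 4 * ((2 * real n + 1) * (2 * real n + 3)) * (?c\<^sup>2 * (2 * real n + 1))"
    by (simp only: power_mult_distrib) (simp add: power2_eq_square algebra_simps del: binomial_Suc_Suc mult_Suc_right)
  also have "\<dots> \<le> 4 * (4 * (real n + 1)\<^sup>2) * (4 ^ n)\<^sup>2"
  proof (rule mult_mono[OF _ Suc.IH])
    show "4 * ((2 * real n + 1) * (2 * real n + 3)) \<le> 4 * (4 * (real n + 1)\<^sup>2)"
      by (simp add: power2_eq_square algebra_simps)
  qed auto
  also have "\<dots> = (real n + 1)\<^sup>2 * (4 ^ Suc n)\<^sup>2"
    by (simp add: power2_eq_square)
  finally show ?case
    by (simp only: mult_le_cancel_left_pos zero_less_power of_nat_0_le_iff add_nonneg_pos zero_less_one)
qed simp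

lemma choose_le: "real (j choose b) \<le> 2 ^ j / sqrt (real j + 1)"
proof -
  have central: "real ((2 * n) choose n) \<le> 4 ^ n / sqrt (2 * real n + 1)" for n
  proof -
    have "sqrt (real ((2 * n) choose n) ^ 2 * (2 * real n + 1)) \<le> sqrt ((4 ^ n)\<^sup>2)"
      using central_binomial_sq_le real_sqrt_le_iff by blast
    then have "real ((2 * n) choose n) * sqrt (2 * real n + 1) \<le> 4 ^ n"
      by (simp only: real_sqrt_mult real_sqrt_abs abs_of_nat power_abs abs_numeral)
    then show ?thesis by (subst pos_le_divide_eq) simp_all
  qed
  have "real (j choose b) \<le> real (j choose (j div 2))"
    by (intro of_nat_mono binomial_maximum)
  also have "\<dots> \<le> 2 ^ j / sqrt (real j + 1)"
  proof (cases "even j")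
    case True
    then obtain n where "j = 2 * n" by blast
    then show ?thesis using central[of n] by (simp add: power_mult)
  next
    case False
    then obtain n where j: "j = 2 * n + 1" using oddE by blast
    \<comment> \<open>In an odd row the two middle coefficients agree, and they add up to the
      central coefficient of the next row.\<close>
    have "(2 * n + 1) choose n = (2 * n + 1) choose Suc n"
      using binomial_symmetric[of n "2 * n + 1"] by simp
    then have "2 * real (j choose n) = real ((2 * Suc n) choose Suc n)"
      by (simp add: j)
    also have "\<dots> \<le> 4 ^ Suc n / sqrt (2 * real (Suc n) + 1)" by (rule central)
    also have "\<dots> \<le> 4 ^ Suc n / sqrt (real j + 1)"
      by (intro divide_left_mono) (auto simp: j)
    finally show ?thesis by (simp add: j power_mult)
  qed
  finally show ?thesis .
qed

text \<open>The shifted endpoints differ in coordinate \<open>l\<close>, so their counts add up to at most the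
  count with that coordinate left free.\<close>

lemma smear_hits_le:
  "smear l j (hits t (Suc l) n) s \<le> 2 ^ j / sqrt (real j + 1) * hits t l n s"
proof -
  let ?c = "2 ^ j / sqrt (real j + 1)" and ?g = "\<lambda>b. s l - 2 * int b"
  have "smear l j (hits t (Suc l) n) s \<le> (\<Sum>b\<le>j. ?c * hits t (Suc l) n (s(l := ?g b)))"
    unfolding smear_def by (intro sum_mono mult_right_mono choose_le hits_nonneg)
  also have "\<dots> = ?c * (\<Sum>b\<in>?g ` {..j}. hits t (Suc l) n (s(l := b)))"
    by (simp add: sum.reindex inj_on_def sum_distrib_left)
  also have "\<dots> \<le> ?c * hits t l n s"
    by (intro mult_left_mono sum_hits_slices_le) auto
  finally show ?thesis .
qed

text \<open>The source of the rate 1/4 in the block bound: advancing by 1 with weight one half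
  counts as advancing by 1/4 for sure. By convexity of the inverse square root, 1/2 would be too
  much. The proof bounds the sum of the two roots by 2ab \<le> a^2 + b^2.\<close>

lemma average_inverse_sqrt_le:
  fixes x :: real
  assumes "1 \<le> x"
  shows "(1 / sqrt x + 1 / sqrt (x + 1)) / 2 \<le> 1 / sqrt (x + 1 / 4)"
proof -
  define a b where "a = sqrt x" and "b = sqrt (x + 1)"
  have ab: "0 < a" "0 < b" "a\<^sup>2 = x" "b\<^sup>2 = x + 1" using assms by (auto simp: a_def b_def)
  have "2 * (a * b) \<le> a\<^sup>2 + b\<^sup>2" using sum_squares_bound[of a b] by simp
  then have "(a + b)\<^sup>2 \<le> 4 * x + 2" using ab by (simp add: power2_sum)
  then have "(a + b)\<^sup>2 * (x + 1 / 4) \<le> (4 * x + 2) * (x + 1 / 4)"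
    using assms by (intro mult_right_mono) auto
  also have "\<dots> \<le> 4 * (x * (x + 1))" using assms by (simp add: algebra_simps)
  also have "\<dots> = (2 * (a * b))\<^sup>2" using ab by (simp add: power_mult_distrib)
  finally have "sqrt ((a + b)\<^sup>2 * (x + 1 / 4)) \<le> sqrt ((2 * (a * b))\<^sup>2)"
    using real_sqrt_le_iff by blast
  then have "(a + b) * sqrt (x + 1 / 4) \<le> 2 * (a * b)"
    using ab by (simp add: real_sqrt_mult)
  then show ?thesis
    using ab assms unfolding a_def[symmetric] b_def[symmetric] by (simp add: field_simps)
qed

section \<open>Exchanging row l with the last row\<close>

lemma card_swappable:
  assumes "Suc l < 2 * t"
  shows "card (halves t) \<le> 4 * card {S \<in> halves t. l \<notin> S \<and> 2 * t - 1 \<in> S}"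
proof -
  obtain u where t: "t = Suc u" using assms by (cases t) auto
  let ?L = "2 * t - 1"
  let ?R = "{..<2 * t} - {l, ?L}"
  \<comment> \<open>Deleting the last row from such a step leaves an arbitrary subset of size
    \<open>u\<close> of the \<open>2 * u\<close> rows other than \<open>l\<close> and the
    last.\<close>
  have "{S \<in> halves t. l \<notin> S \<and> ?L \<in> S} = insert ?L ` {R. R \<subseteq> ?R \<and> card R = u}"
  proof (intro equalityI subsetI)
    fix S assume "S \<in> {S \<in> halves t. l \<notin> S \<and> ?L \<in> S}"
    then have "S = insert ?L (S - {?L})" "S - {?L} \<subseteq> ?R" "card (S - {?L}) = u"
      by (auto simp: halves_def t)
    then show "S \<in> insert ?L ` {R. R \<subseteq> ?R \<and> card R = u}" by blast
  next
    fix S assume "S \<in> insert ?L ` {R. R \<subseteq> ?R \<and> card R = u}"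
    then obtain R where R: "S = insert ?L R" "R \<subseteq> ?R" "card R = u" by blast
    then have "finite R" by (auto intro: finite_subset)
    then have "card S = t" using R t by (subst R(1), subst card_insert_disjoint) auto
    then show "S \<in> {S \<in> halves t. l \<notin> S \<and> ?L \<in> S}"
      using R assms by (auto simp: halves_def)
  qed
  moreover have "inj_on (insert ?L) {R. R \<subseteq> ?R \<and> card R = u}"
    by (rule inj_onI) blast
  moreover have "card ?R = 2 * u" using assms by (simp add: t)
  ultimately have P: "card {S \<in> halves t. l \<notin> S \<and> ?L \<in> S} = (2 * u) choose u"
    by (simp add: card_image n_subsets)
  \<comment> \<open>The ratio of consecutive central binomial coefficients is 2(2u + 1) / (u + 1),
    which is below 4.\<close>
  have "Suc u * ((2 * Suc u) choose Suc u) = 2 * (2 * u + 1) * ((2 * u) choose u)"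
    by (rule Suc_times_central_binomial)
  also have "\<dots> \<le> Suc u * (4 * ((2 * u) choose u))" by (simp add: algebra_simps)
  finally have "(2 * Suc u) choose Suc u \<le> 4 * ((2 * u) choose u)"
    by (simp only: Suc_mult_le_cancel1)
  then show ?thesis using P by (simp add: card_halves t)
qed

text \<open>The exchange is a bijection between the steps containing only the last row and those
  containing only row \<open>l\<close>; the remaining steps are summed separately.\<close>

lemma sum_swap_pairs:
  fixes f :: "nat set \<Rightarrow> real"
  assumes l: "Suc l < 2 * t"
  shows "(\<Sum>S\<in>halves t. f S)
    = (\<Sum>S\<in>{S \<in> halves t. l \<in> S \<longleftrightarrow> 2 * t - 1 \<in> S}. f S)
      + (\<Sum>S\<in>{S \<in> halves t. l \<notin> S \<and> 2 * t - 1 \<in> S}. f S + f (insert l (S - {2 * t - 1})))"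
proof -
  let ?L = "2 * t - 1"
  let ?I = "{S \<in> halves t. l \<in> S \<longleftrightarrow> ?L \<in> S}"
  let ?P = "{S \<in> halves t. l \<in> S \<and> ?L \<notin> S}" and ?Q = "{S \<in> halves t. l \<notin> S \<and> ?L \<in> S}"
  have swap: "insert b (S - {a}) \<in> halves t"
    if "S \<in> halves t" "a \<in> S" "b \<notin> S" "b < 2 * t" for S a b
  proof -
    from that have S: "finite S" "card S = t" "S \<subseteq> {..<2 * t}"
      by (auto simp: halves_def intro: finite_subset)
    with that have "card (insert b (S - {a})) = t"
      using card_Suc_Diff1[of S a] by simp
    with that S show ?thesis by (auto simp: halves_def)
  qed
  have "(\<Sum>S\<in>?P. f S) = (\<Sum>S\<in>?Q. f (insert l (S - {?L})))"
  proof (rule sum.reindex_bij_witness[of _ "\<lambda>S. insert l (S - {?L})" "\<lambda>S. insert ?L (S - {l})"])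
    fix S assume S: "S \<in> ?P"
    show "insert l (insert ?L (S - {l}) - {?L}) = S" using S l by auto
    then show "f (insert l (insert ?L (S - {l}) - {?L})) = f S" by simp
    show "insert ?L (S - {l}) \<in> ?Q" using S l by (auto intro!: swap)
  next
    fix S assume S: "S \<in> ?Q"
    show "insert ?L (insert l (S - {?L}) - {l}) = S" using S l by auto
    show "insert l (S - {?L}) \<in> ?P" using S l by (auto intro!: swap)
  qed
  moreover have "(\<Sum>S\<in>halves t. f S) = (\<Sum>S\<in>?I. f S) + ((\<Sum>S\<in>?P. f S) + (\<Sum>S\<in>?Q. f S))"
  proof -
    have "halves t = ?I \<union> (?P \<union> ?Q)" by auto
    then have "(\<Sum>S\<in>halves t. f S) = (\<Sum>S\<in>?I \<union> (?P \<union> ?Q). f S)" by (rule arg_cong)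
    also have "\<dots> = (\<Sum>S\<in>?I. f S) + (\<Sum>S\<in>?P \<union> ?Q. f S)"
      by (rule sum.union_disjoint) auto
    also have "(\<Sum>S\<in>?P \<union> ?Q. f S) = (\<Sum>S\<in>?P. f S) + (\<Sum>S\<in>?Q. f S)"
      by (rule sum.union_disjoint) auto
    finally show ?thesis .
  qed
  ultimately show ?thesis by (simp add: sum.distrib)
qed

text \<open>The two steps of a pair differ by 2 in coordinate \<open>l\<close> and otherwise only in
  the last coordinate, which lies beyond \<open>l\<close> and is not prescribed. By
  \<open>smear_Suc\<close> the two terms merge into one with \<open>j\<close> advanced.\<close>

lemma smear_hits_Suc_pairs:
  assumes l: "Suc l < 2 * t"
  shows "smear l j (hits t (Suc l) (Suc n)) s
    = (\<Sum>S\<in>{S \<in> halves t. l \<in> S \<longleftrightarrow> 2 * t - 1 \<in> S}. smear l j (hits t (Suc l) n) (\<lambda>i. s i - sg S i))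
      + (\<Sum>S\<in>{S \<in> halves t. l \<notin> S \<and> 2 * t - 1 \<in> S}.
          smear l (Suc j) (hits t (Suc l) n) (\<lambda>i. s i - sg S i))"
proof -
  have "smear l j (hits t (Suc l) n) (\<lambda>i. s i - sg (insert l (S - {2 * t - 1})) i)
      = smear l j (hits t (Suc l) n) ((\<lambda>i. s i - sg S i)(l := s l - sg S l - 2))"
    if "l \<notin> S" for S
    using that l by (intro smear_hits_cong) (auto simp: sg_def)
  then show ?thesis
    unfolding smear_hits_Suc sum_swap_pairs[OF l] smear_Suc by simp
qed

text \<open>Only steps separating row \<open>l\<close> from the last row advance \<open>j\<close>; as they make up at least
  half of all steps, each step adds at least \<open>1 / 4\<close> to the quantity under the root.\<close>

lemma smear_hits_block_le:
  assumes l: "Suc l < 2 * t" and M: "\<And>s. hits t l K s \<le> M"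
  shows "smear l j (hits t (Suc l) (K + k)) s
    \<le> M * real (card (halves t)) ^ k * 2 ^ j / sqrt (real k / 4 + real j + 1)"
proof (induction k arbitrary: j s)
  case 0
  have "smear l j (hits t (Suc l) K) s \<le> 2 ^ j / sqrt (real j + 1) * M"
    by (rule order_trans[OF smear_hits_le]) (intro mult_left_mono M, simp)
  then show ?case by (simp add: mult.commute)
next
  case (Suc k)
  let ?L = "2 * t - 1"
  define I Q where "I = {S \<in> halves t. l \<in> S \<longleftrightarrow> ?L \<in> S}" and "Q = {S \<in> halves t. l \<notin> S \<and> ?L \<in> S}"
  define v a b c x where "v = real (card (halves t))" and "a = real (card I)" and "b = real (card Q)"
    and "c = M * v ^ k * 2 ^ j" and "x = real k / 4 + real j + 1"
  have "0 \<le> M" using M[of "\<lambda>_. 0"] hits_nonneg order_trans by blast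
  then have "0 \<le> c" by (simp add: c_def v_def)
  have x: "1 \<le> x" by (simp add: x_def)
  have "v \<le> 4 * b"
    using card_swappable[OF l] by (simp add: v_def b_def Q_def flip: of_nat_le_iff[where 'a = real])
  have "v = a + 2 * b"
    using sum_swap_pairs[OF l, of "\<lambda>_. 1"] by (simp add: v_def a_def b_def I_def Q_def)
  have "smear l j (hits t (Suc l) (K + Suc k)) s
      = (\<Sum>S\<in>I. smear l j (hits t (Suc l) (K + k)) (\<lambda>i. s i - sg S i))
        + (\<Sum>S\<in>Q. smear l (Suc j) (hits t (Suc l) (K + k)) (\<lambda>i. s i - sg S i))"
    by (simp add: smear_hits_Suc_pairs[OF l] I_def Q_def)
  also have "\<dots> \<le> (\<Sum>S\<in>I. c / sqrt x) + (\<Sum>S\<in>Q. 2 * c / sqrt (x + 1))"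
  proof (intro add_mono sum_mono)
    fix S
    show "smear l j (hits t (Suc l) (K + k)) (\<lambda>i. s i - sg S i) \<le> c / sqrt x"
      using Suc.IH by (simp add: c_def v_def x_def)
    have "x + 1 = real k / 4 + real (Suc j) + 1" "2 * c = M * v ^ k * 2 ^ Suc j"
      by (simp_all add: x_def c_def)
    then show "smear l (Suc j) (hits t (Suc l) (K + k)) (\<lambda>i. s i - sg S i) \<le> 2 * c / sqrt (x + 1)"
      using Suc.IH by (simp only: v_def)
  qed
  also have "\<dots> = c * (a / sqrt x + 2 * b / sqrt (x + 1))"
    by (simp add: a_def b_def algebra_simps)
  also have "\<dots> \<le> c * (v * ((1 / sqrt x + 1 / sqrt (x + 1)) / 2))"
  proof (intro mult_left_mono \<open>0 \<le> c\<close>)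
    \<comment> \<open>The weights \<open>a\<close> and \<open>2 * b\<close> add up to
      \<open>v\<close>, and the smaller value \<open>q\<close> has at least half of the weight;
      equalizing the weights can only increase the total.\<close>
    have "a * p + 2 * b * q \<le> v * ((p + q) / 2)" if "q \<le> p" for p q
    proof -
      have "(2 * b - v / 2) * q \<le> (2 * b - v / 2) * p"
        using \<open>v \<le> 4 * b\<close> that by (intro mult_left_mono) auto
      then show ?thesis unfolding \<open>v = a + 2 * b\<close> by (simp add: field_simps)
    qed
    from this[of "1 / sqrt (x + 1)" "1 / sqrt x"]
    show "a / sqrt x + 2 * b / sqrt (x + 1) \<le> v * ((1 / sqrt x + 1 / sqrt (x + 1)) / 2)"
      using x by (simp add: frac_le)
  qed
  also have "\<dots> \<le> c * (v * (1 / sqrt (x + 1 / 4)))"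
    using average_inverse_sqrt_le[OF x] \<open>0 \<le> c\<close> by (intro mult_left_mono) (auto simp: v_def)
  also have "\<dots> = M * v ^ Suc k * 2 ^ j / sqrt (real (Suc k) / 4 + real j + 1)"
    by (simp add: c_def x_def algebra_simps add_divide_distrib)
  finally show ?case by (simp add: v_def)
qed

text \<open>Each coordinate uses its own block of \<open>k\<close> steps, entered with
  \<open>j = 0\<close>, where \<open>smear\<close> is \<open>hits\<close> itself. The bound for the
  remaining steps holds uniformly in the endpoint, as the block lemma requires; \<open>r\<close> is
  the remainder of the division into blocks.\<close>

lemma hits_blocks_le:
  assumes "l < 2 * t"
  shows "hits t l (r + l * k) s \<le> real (card (halves t)) ^ (r + l * k) / sqrt (real k / 4 + 1) ^ l"
  using assms
proof (induction l arbitrary: s)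
  case 0
  then show ?case by (simp add: hits_no_coordinates)
next
  case (Suc l)
  let ?v = "real (card (halves t))"
  have "smear l 0 (hits t (Suc l) (r + l * k + k)) s
      \<le> ?v ^ (r + l * k) / sqrt (real k / 4 + 1) ^ l * ?v ^ k * 2 ^ 0 / sqrt (real k / 4 + real 0 + 1)"
    using Suc by (intro smear_hits_block_le) auto
  moreover have "smear l 0 (hits t (Suc l) (r + l * k + k)) s = hits t (Suc l) (r + Suc l * k) s"
    by (simp add: smear_def algebra_simps)
  ultimately show ?case by (simp add: power_add mult_ac)
qed

lemma hits_le:
  assumes "0 < t" and d: "d = 2 * t - 1" and "0 < n"
  shows "hits t d n s \<le> real (card (halves t)) ^ n * sqrt (4 * real d) ^ d / sqrt (real n) ^ d"
proof -
  have "0 < d" using assms by simp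
  define k r where "k = n div d" and "r = n mod d"
  have n: "n = r + d * k" by (simp add: k_def r_def)
  have "n \<le> d * (k + 1)" using n mod_less_divisor[OF \<open>0 < d\<close>, of n] by (simp add: r_def)
  then have "real n \<le> real d * (real k + 1)"
    by (metis of_nat_1 of_nat_add of_nat_le_iff of_nat_mult)
  \<comment> \<open>The 4 offsets the rate 1/4 at which a block gains.\<close>
  also have "\<dots> \<le> 4 * real d * (real k / 4 + 1)" by (simp add: algebra_simps)
  finally have "sqrt (real n) \<le> sqrt (4 * real d) * sqrt (real k / 4 + 1)"
    by (simp flip: real_sqrt_mult)
  then have "sqrt (real n) ^ d \<le> sqrt (4 * real d) ^ d * sqrt (real k / 4 + 1) ^ d"
    by (metis power_mono power_mult_distrib real_sqrt_ge_zero of_nat_0_le_iff)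
  moreover have "0 < sqrt (real k / 4 + 1) ^ d" "0 < sqrt (real n) ^ d"
    using \<open>0 < n\<close> by (auto intro!: zero_less_power add_nonneg_pos)
  ultimately have "1 / sqrt (real k / 4 + 1) ^ d \<le> sqrt (4 * real d) ^ d / sqrt (real n) ^ d"
    by (simp add: field_simps)
  then have "real (card (halves t)) ^ n * (1 / sqrt (real k / 4 + 1) ^ d)
      \<le> real (card (halves t)) ^ n * (sqrt (4 * real d) ^ d / sqrt (real n) ^ d)"
    by (rule mult_left_mono) simp
  moreover have "hits t d n s \<le> real (card (halves t)) ^ n * (1 / sqrt (real k / 4 + 1) ^ d)"
    using hits_blocks_le[of d t r k s] assms n by simp
  ultimately show ?thesis by simp
qed

lemma alpha_eq_sum:
  assumes "0 < t" and "m = 2 * t \<or> m = 2 * t - 1"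
  shows "real (alpha m n) = (\<Sum>xs\<in>walks t n. of_bool (\<forall>i<m. \<bar>disp xs i\<bar> \<le> 1))"
  using alpha_eq_card_walks[OF assms, of n] by (simp add: Int_def)

text \<open>The first \<open>d\<close> coordinates of an admissible endpoint form one of
  \<open>3 ^ d\<close> points, and \<open>hits_le\<close> applies to each of them.\<close>

lemma alpha_le:
  assumes "0 < t" and m: "m = 2 * t \<or> m = 2 * t - 1" and d: "d = 2 * t - 1" and "0 < n"
  shows "real (alpha m n)
    \<le> 3 ^ d * sqrt (4 * real d) ^ d * (real (card (halves t)) ^ n / sqrt (real n) ^ d)"
proof -
  let ?B = "{..<d} \<rightarrow>\<^sub>E {-1..1 :: int}"
  have fin: "finite ?B" by (intro finite_PiE) auto
  have "real (alpha m n) = (\<Sum>xs\<in>walks t n. of_bool (\<forall>i<m. \<bar>disp xs i\<bar> \<le> 1))"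
    using assms by (intro alpha_eq_sum)
  also have "\<dots> \<le> (\<Sum>xs\<in>walks t n. \<Sum>s\<in>?B. of_bool (\<forall>i<d. disp xs i = s i))"
  proof (intro sum_mono)
    fix xs
    show "of_bool (\<forall>i<m. \<bar>disp xs i\<bar> \<le> 1) \<le> (\<Sum>s\<in>?B. of_bool (\<forall>i<d. disp xs i = s i) :: real)"
    proof (cases "\<forall>i<m. \<bar>disp xs i\<bar> \<le> 1")
      case True
      let ?s = "restrict (disp xs) {..<d}"
      have "\<forall>i<d. \<bar>disp xs i\<bar> \<le> 1" using True m d by auto
      then have "?s \<in> ?B" by (intro restrict_PiE_iff[THEN iffD2]) (auto simp: abs_le_iff)
      then have "of_bool (\<forall>i<d. disp xs i = ?s i) \<le> (\<Sum>s\<in>?B. of_bool (\<forall>i<d. disp xs i = s i) :: real)"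
        by (rule member_le_sum[OF _ _ fin]) simp
      then show ?thesis by simp
    qed (auto intro: sum_nonneg)
  qed
  also have "\<dots> = (\<Sum>s\<in>?B. hits t d n s)"
    unfolding hits_def by (rule sum.swap)
  also have "\<dots> \<le> (\<Sum>s\<in>?B. real (card (halves t)) ^ n * sqrt (4 * real d) ^ d / sqrt (real n) ^ d)"
    using assms by (intro sum_mono hits_le)
  also have "card ?B = 3 ^ d" by (simp add: card_PiE)
  then have "(\<Sum>s\<in>?B. real (card (halves t)) ^ n * sqrt (4 * real d) ^ d / sqrt (real n) ^ d)
      = 3 ^ d * sqrt (4 * real d) ^ d * (real (card (halves t)) ^ n / sqrt (real n) ^ d)"
    by simp
  finally show ?thesis .
qed

subsection \<open>The lower bound\<close>

lemma sum_halves_complement: "(\<Sum>S\<in>halves t. f S) = (\<Sum>S\<in>halves t. f ({..<2 * t} - S))"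
proof -
  have "{..<2 * t} - S \<in> halves t \<and> {..<2 * t} - ({..<2 * t} - S) = S" if "S \<in> halves t" for S
    using that finite_subset[of S "{..<2 * t}"] by (auto simp: halves_def card_Diff_subset)
  then show ?thesis
    by (intro sum.reindex_bij_witness[of _ "\<lambda>S. {..<2 * t} - S" "\<lambda>S. {..<2 * t} - S"]) auto
qed

lemma sg_complement: "i < 2 * t \<Longrightarrow> sg ({..<2 * t} - S) i = - sg S i"
  by (auto simp: sg_def)

lemma sum_halves_sg:
  assumes "i < 2 * t"
  shows "(\<Sum>S\<in>halves t. sg S i) = 0"
  using sum_halves_complement[of "\<lambda>S. sg S i" t] assms by (simp add: sg_complement sum_negf)

text \<open>The variance of a walk with centred steps of size 1, scaled by the number of walks: the
  cross terms vanish by \<open>sum_halves_sg\<close>.\<close>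

lemma sum_disp_sq:
  assumes "i < 2 * t"
  shows "(\<Sum>xs\<in>walks t n. (real_of_int (disp xs i))\<^sup>2) = real n * real (card (halves t)) ^ n"
proof (induction n)
  case (Suc n)
  have sg: "(\<Sum>S\<in>halves t. real_of_int (sg S i)) = 0"
    using sum_halves_sg[OF assms] by (metis of_int_0 of_int_sum)
  have "(\<Sum>xs\<in>walks t (Suc n). (real_of_int (disp xs i))\<^sup>2)
      = (\<Sum>S\<in>halves t. \<Sum>xs\<in>walks t n. 1 + 2 * real_of_int (disp xs i) * real_of_int (sg S i) + (real_of_int (disp xs i))\<^sup>2)"
    unfolding sum_walks_Suc by (intro sum.cong refl) (auto simp: sg_def power2_eq_square algebra_simps)
  also have "\<dots> = real (card (halves t)) ^ Suc n + (\<Sum>S\<in>halves t. \<Sum>xs\<in>walks t n. 2 * real_of_int (disp xs i) * real_of_int (sg S i))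
      + card (halves t) * (real n * real (card (halves t)) ^ n)"
    by (simp add: sum.distrib card_walks Suc.IH)
  also have "(\<Sum>S\<in>halves t. \<Sum>xs\<in>walks t n. 2 * real_of_int (disp xs i) * real_of_int (sg S i)) = 0"
    by (subst sum.swap) (simp add: sg flip: sum_distrib_left)
  finally show ?case by (simp add: algebra_simps)
qed simp

text \<open>Complementing every step negates all coordinates below \<open>2 * t\<close>.\<close>

lemma hits_uminus:
  assumes "l \<le> 2 * t"
  shows "hits t l n (\<lambda>i. - s i) = hits t l n s"
proof (induction n arbitrary: s)
  case (Suc n)
  have "hits t l (Suc n) (\<lambda>i. - s i) = (\<Sum>S\<in>halves t. hits t l n (\<lambda>i. - s i - sg ({..<2 * t} - S) i))"
    unfolding hits_Suc by (rule sum_halves_complement)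
  also have "\<dots> = (\<Sum>S\<in>halves t. hits t l n (\<lambda>i. - (s i - sg S i)))"
    using assms by (intro sum.cong refl hits_cong) (simp add: sg_complement)
  finally show ?case by (simp only: Suc.IH hits_Suc)
qed (simp add: hits_def)

section \<open>Closed walks from pairs of half-length walks\<close>

lemma hits_add: "hits t l (a + b) s = (\<Sum>ys\<in>walks t a. hits t l b (\<lambda>i. s i - disp ys i))"
  unfolding hits_def sum_walks_add by (intro sum.cong refl) (auto simp: algebra_simps)

text \<open>By Cauchy-Schwarz, at least \<open>(card R)^2 / card B\<close> pairs from
  \<open>R\<close> share an endpoint, and negating one walk of such a pair closes the other one
  up.\<close>

lemma hits_double_ge:
  assumes "l \<le> 2 * t" and R: "R \<subseteq> walks t k" and B: "finite B"
    and RB: "\<And>xs. xs \<in> R \<Longrightarrow> restrict (disp xs) {..<l} \<in> B"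
  shows "(real (card R))\<^sup>2 \<le> hits t l (k + k) (\<lambda>_. 0) * card B"
proof -
  let ?g = "\<lambda>xs. restrict (disp xs) {..<l}"
  have finR: "finite R" using R by (rule finite_subset) simp
  define h where "h s = (\<Sum>xs\<in>{xs \<in> R. ?g xs = s}. 1 :: real)" for s
  have h: "h (?g ys) \<le> hits t l k (disp ys)" for ys
  proof -
    have "h (?g ys) = (\<Sum>xs\<in>R. of_bool (?g xs = ?g ys))"
      using finR by (simp add: h_def Int_def)
    also have "\<dots> \<le> (\<Sum>xs\<in>walks t k. of_bool (?g xs = ?g ys))"
      using R by (intro sum_mono2) auto
    also have "\<dots> \<le> hits t l k (disp ys)"
      unfolding hits_def
    proof (intro sum_mono)
      fix xs
      have "\<forall>i<l. disp xs i = disp ys i" if "?g xs = ?g ys"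
        using that by (metis lessThan_iff restrict_apply)
      then show "of_bool (?g xs = ?g ys) \<le> (of_bool (\<forall>i<l. disp xs i = disp ys i) :: real)"
        by auto
    qed
    finally show ?thesis .
  qed
  have "(\<Sum>s\<in>B. h s) = real (card R)"
    unfolding h_def using finR B RB by (subst sum.group) auto
  then have "(real (card R))\<^sup>2 \<le> (\<Sum>s\<in>B. (h s)\<^sup>2) * card B"
    using sum_squared_le_sum_of_squares[of h B] by simp
  \<comment> \<open>The sum of squares counts these pairs; here it is regrouped by the first
    member.\<close>
  also have "(\<Sum>s\<in>B. (h s)\<^sup>2) = (\<Sum>s\<in>B. \<Sum>xs\<in>{xs \<in> R. ?g xs = s}. h (?g xs))"
    by (intro sum.cong refl) (simp add: h_def power2_eq_square)
  also have "\<dots> = (\<Sum>xs\<in>R. h (?g xs))"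
    using finR B RB by (intro sum.group) auto
  also have "\<dots> \<le> (\<Sum>xs\<in>R. hits t l k (disp xs))"
    by (intro sum_mono h)
  also have "\<dots> \<le> (\<Sum>xs\<in>walks t k. hits t l k (disp xs))"
    using R by (intro sum_mono2 hits_nonneg) auto
  also have "\<dots> = (\<Sum>xs\<in>walks t k. hits t l k (\<lambda>i. - disp xs i))"
    using assms by (simp add: hits_uminus)
  also have "\<dots> = hits t l (k + k) (\<lambda>_. 0)"
    unfolding hits_add by simp
  finally show ?thesis by (simp add: mult_right_mono)
qed

text \<open>Chebyshev: the threshold \<open>2 * d * k\<close> is \<open>2 * d\<close> times the
  variance, so each coordinate fails for at most a fraction 1/(2d) of the walks, and
  \<open>d\<close> coordinates together for at most half.\<close>

lemma card_small_walks_ge: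
  assumes "0 < d" "d \<le> 2 * t" "0 < k"
  shows "real (card (halves t)) ^ k / 2
    \<le> card {xs \<in> walks t k. \<forall>i<d. (real_of_int (disp xs i))\<^sup>2 \<le> 2 * real d * real k}"
proof -
  let ?c = "2 * real d * real k" and ?w = "real (card (halves t)) ^ k"
  let ?R = "{xs \<in> walks t k. \<forall>i<d. (real_of_int (disp xs i))\<^sup>2 \<le> ?c}"
  define Bad where "Bad i = {xs \<in> walks t k. ?c < (real_of_int (disp xs i))\<^sup>2}" for i
  have fin: "finite (Bad i)" for i by (simp add: Bad_def)
  have bad: "real (card (Bad i)) \<le> ?w / (2 * real d)" if "i < d" for i
  proof -
    have "?c * card (Bad i) = (\<Sum>xs\<in>Bad i. ?c)" by simp
    also have "\<dots> \<le> (\<Sum>xs\<in>Bad i. (real_of_int (disp xs i))\<^sup>2)"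
      by (intro sum_mono) (simp add: Bad_def)
    also have "\<dots> \<le> (\<Sum>xs\<in>walks t k. (real_of_int (disp xs i))\<^sup>2)"
      by (intro sum_mono2) (auto simp: Bad_def)
    also have "\<dots> = k * ?w" using that assms by (intro sum_disp_sq) auto
    finally show ?thesis using assms by (simp add: field_simps)
  qed
  have "walks t k = ?R \<union> (\<Union>i<d. Bad i)" by (auto simp: Bad_def not_le)
  then have "card (walks t k) = card (?R \<union> (\<Union>i<d. Bad i))" by (rule arg_cong)
  also have "\<dots> \<le> card ?R + card (\<Union>i<d. Bad i)" by (rule card_Un_le)
  also have "\<dots> \<le> card ?R + (\<Sum>i<d. card (Bad i))"
    by (intro add_left_mono card_UN_le) simp
  finally have "real (card (walks t k)) \<le> real (card ?R + (\<Sum>i<d. card (Bad i)))"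
    by (rule of_nat_mono)
  then have "?w \<le> card ?R + (\<Sum>i<d. real (card (Bad i)))"
    by (simp only: card_walks of_nat_add of_nat_power of_nat_sum)
  also have "\<dots> \<le> card ?R + (\<Sum>i<d. ?w / (2 * real d))"
    by (intro add_left_mono sum_mono bad) simp
  finally show ?thesis using assms by simp
qed

text \<open>The 4 is the square of the lost factor 2 from Chebyshev. The box side
  \<open>2 * \<lfloor>\<rho>\<rfloor> + 1\<close> is at most \<open>3 * \<rho>\<close> because
  \<open>\<rho>\<close> is at least 1.\<close>

lemma hits_return_ge:
  assumes "0 < d" "d \<le> 2 * t" "0 < k"
  shows "real (card (halves t)) ^ (2 * k) / (4 * (3 * sqrt (2 * real d * real k)) ^ d)
    \<le> hits t d (2 * k) (\<lambda>_. 0)"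
proof -
  define \<rho> where "\<rho> = sqrt (2 * real d * real k)"
  let ?w = "real (card (halves t)) ^ k"
  let ?R = "{xs \<in> walks t k. \<forall>i<d. (real_of_int (disp xs i))\<^sup>2 \<le> 2 * real d * real k}"
  let ?B = "{..<d} \<rightarrow>\<^sub>E {-\<lfloor>\<rho>\<rfloor>..\<lfloor>\<rho>\<rfloor>}"
  have "1 \<le> real d * real k" using assms by (metis Suc_leI of_nat_1 of_nat_le_iff of_nat_mult One_nat_def nat_0_less_mult_iff)
  then have \<rho>: "1 \<le> \<rho>" by (simp add: \<rho>_def)
  have "real (card ?B) = (real (nat (2 * \<lfloor>\<rho>\<rfloor> + 1))) ^ d"
    by (simp add: card_PiE algebra_simps)
  also have "\<dots> \<le> (3 * \<rho>) ^ d"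
    using \<rho> by (intro power_mono) linarith+
  finally have cardB: "real (card ?B) \<le> (3 * \<rho>) ^ d" .
  have "(?w / 2)\<^sup>2 \<le> (real (card ?R))\<^sup>2"
    using card_small_walks_ge[OF assms] by (intro power_mono) auto
  also have "\<dots> \<le> hits t d (k + k) (\<lambda>_. 0) * card ?B"
  proof (rule hits_double_ge)
    fix xs assume "xs \<in> ?R"
    then have "\<bar>real_of_int (disp xs i)\<bar> \<le> \<rho>" if "i < d" for i
      using that real_sqrt_le_mono[of "(real_of_int (disp xs i))\<^sup>2" "2 * real d * real k"]
      by (simp add: \<rho>_def)
    then have "disp xs i \<in> {-\<lfloor>\<rho>\<rfloor>..\<lfloor>\<rho>\<rfloor>}" if "i < d" for i
      using that by (simp add: le_floor_iff abs_le_iff minus_le_iff[of "\<lfloor>\<rho>\<rfloor>"])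
    then show "restrict (disp xs) {..<d} \<in> ?B" by auto
  qed (use assms in \<open>auto intro: finite_PiE\<close>)
  also have "\<dots> \<le> hits t d (k + k) (\<lambda>_. 0) * (3 * \<rho>) ^ d"
    by (intro mult_left_mono cardB hits_nonneg)
  finally have "?w\<^sup>2 / 4 \<le> hits t d (2 * k) (\<lambda>_. 0) * (3 * \<rho>) ^ d"
    by (simp add: power_divide mult_2)
  then show ?thesis
    using \<rho> unfolding \<rho>_def[symmetric] by (simp add: field_simps power_mult power2_eq_square)
qed

lemma alpha_ge:
  assumes "0 < t" and m: "m = 2 * t \<or> m = 2 * t - 1" and d: "d = 2 * t - 1" and "2 \<le> n"
  shows "1 / (4 * (3 * sqrt (real d)) ^ d) * (real (card (halves t)) ^ n / sqrt (real n) ^ d)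
    \<le> real (alpha m n)"
proof -
  let ?v = "real (card (halves t))"
  have dt: "2 * t = Suc d" "0 < d" using assms by auto
  define k where "k = n div 2"
  have k: "0 < k" "n = 2 * k \<or> n = Suc (2 * k)" using \<open>2 \<le> n\<close> by (auto simp: k_def)
  \<comment> \<open>For \<open>m = 2 * t\<close> the last coordinate must vanish as well; it does
    because all coordinates sum to zero.\<close>
  have return: "disp xs i = 0" if "xs \<in> walks t (2 * k)" "\<forall>i<d. disp xs i = 0" "i < m" for xs i
  proof (cases "i < d")
    case False
    then have "i = d" using that m dt by auto
    then show ?thesis using sum_disp[OF that(1)] that(2) unfolding dt by simp
  qed (use that in simp)
  have "?v ^ (n - 2 * k) * hits t d (2 * k) (\<lambda>_. 0) \<le> real (alpha m n)"
    using k(2)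
  proof
    assume n: "n = 2 * k"
    have "hits t d (2 * k) (\<lambda>_. 0) \<le> real (alpha m n)"
      unfolding alpha_eq_sum[OF assms(1,2)] hits_def n by (intro sum_mono) (simp add: return)
    then show ?thesis by (simp add: n)
  next
    \<comment> \<open>An arbitrary step put before a closed walk leaves every coordinate at 1 or
      -1.\<close>
    assume n: "n = Suc (2 * k)"
    have "?v * hits t d (2 * k) (\<lambda>_. 0)
        = (\<Sum>S\<in>halves t. \<Sum>xs\<in>walks t (2 * k). of_bool (\<forall>i<d. disp xs i = 0))"
      by (simp add: hits_def)
    also have "\<dots> \<le> real (alpha m n)"
      unfolding alpha_eq_sum[OF assms(1,2)] n sum_walks_Suc
      by (intro sum_mono) (simp add: return sg_def)
    finally show ?thesis by (simp add: n)
  qed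
  moreover have "?v ^ (2 * k) / (4 * (3 * sqrt (2 * real d * real k)) ^ d) \<le> hits t d (2 * k) (\<lambda>_. 0)"
    using dt k by (intro hits_return_ge) auto
  ultimately have "?v ^ (n - 2 * k) * (?v ^ (2 * k) / (4 * (3 * sqrt (2 * real d * real k)) ^ d))
      \<le> real (alpha m n)"
    by (meson mult_left_mono order_trans zero_le_power of_nat_0_le_iff)
  \<comment> \<open>Since \<open>2 * k\<close> is at most \<open>n\<close>, passing to
    \<open>n\<close> only enlarges the denominator.\<close>
  moreover have "?v ^ n / (4 * (3 * sqrt (real d * real n)) ^ d)
      \<le> ?v ^ n / (4 * (3 * sqrt (2 * real d * real k)) ^ d)"
  proof (intro divide_left_mono mult_left_mono power_mono mult_pos_pos)
    show "sqrt (2 * real d * real k) \<le> sqrt (real d * real n)"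
      using k by (auto simp: algebra_simps)
  qed (use k dt in auto)
  moreover have "?v ^ n = ?v ^ (n - 2 * k) * ?v ^ (2 * k)"
    using k by (auto simp flip: power_add)
  ultimately have "?v ^ n / (4 * (3 * sqrt (real d * real n)) ^ d) \<le> real (alpha m n)"
    by simp
  then show ?thesis by (simp add: real_sqrt_mult power_mult_distrib)
qed

section \<open>Assembling the two bounds\<close>

theorem theorem5:
  "(\<forall>m::nat. 0 < m \<longrightarrow>
      (\<lambda>n::nat. real (alpha m n)) \<in>
        \<Theta>(\<lambda>n. real (alpha m 1) ^ n / real n powr (real ((m - 1) div 2) + 1 / 2)) \<and>
      (\<exists>c1 c2 :: real. 0 < c1 \<and> c1 \<le> c2 \<and>
        (\<forall>\<^sub>F n in sequentially.
          c1 * (real (alpha m 1) ^ n / real n powr (real ((m - 1) div 2) + 1 / 2)) \<le> real (alpha m n) \<and>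
          real (alpha m n) \<le> c2 * (real (alpha m 1) ^ n / real n powr (real ((m - 1) div 2) + 1 / 2))))) \<and>
   (\<forall>t::nat. 0 < t \<longrightarrow>
      alpha (2 * t - 1) 1 = (2 * t) choose t \<and> alpha (2 * t) 1 = (2 * t) choose t)"
proof (intro conjI allI impI)
  fix m :: nat assume "0 < m"
  \<comment> \<open>The choice for which \<open>m\<close> is \<open>2 * t - 1\<close> or
    \<open>2 * t\<close>; half of \<open>d\<close> is then the exponent in the theorem.\<close>
  define t where "t = Suc ((m - 1) div 2)"
  define d where "d = 2 * t - 1"
  define f where "f = (\<lambda>n. real (alpha m 1) ^ n / real n powr (real ((m - 1) div 2) + 1 / 2))"
  have t: "0 < t" "m = 2 * t \<or> m = 2 * t - 1" using \<open>0 < m\<close> by (auto simp: t_def)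
  \<comment> \<open>The constants of \<open>alpha_ge\<close> and \<open>alpha_le\<close>; they are
    separated by 1, which yields \<open>c1 \<le> c2\<close>.\<close>
  define c1 c2 where "c1 = 1 / (4 * (3 * sqrt (real d)) ^ d)"
    and "c2 = 3 ^ d * sqrt (4 * real d) ^ d"
  have d: "1 \<le> d" using t by (simp add: d_def)
  then have "1 \<le> 3 * sqrt (real d)" "1 \<le> 3 * sqrt (4 * real d)"
    using real_sqrt_ge_one[of "real d"] real_sqrt_ge_one[of "4 * real d"] by linarith+
  then have "1 \<le> (3 * sqrt (real d)) ^ d" "1 \<le> (3 * sqrt (4 * real d)) ^ d"
    by (blast intro: one_le_power)+
  then have c: "0 < c1" "c1 \<le> 1" "1 \<le> c2"
    unfolding c1_def c2_def power_mult_distrib[of 3 "sqrt (4 * real d)", symmetric]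
    by (linarith | simp only: divide_le_eq_1_pos zero_less_divide_1_iff)+
  have f: "f n = real (card (halves t)) ^ n / sqrt (real n) ^ d" if "0 < n" for n
  proof -
    have "d = 2 * ((m - 1) div 2) + 1" by (simp add: d_def t_def)
    then have e: "real ((m - 1) div 2) + 1 / 2 = 1 / 2 * real d" by (simp only:) simp
    have "real n powr (real ((m - 1) div 2) + 1 / 2) = (real n powr (1 / 2)) powr real d"
      unfolding e powr_powr ..
    also have "\<dots> = sqrt (real n) ^ d"
      using that by (simp add: powr_half_sqrt powr_realpow)
    finally show ?thesis using alpha_1[OF t] by (simp add: f_def card_halves)
  qed
  have ev: "\<forall>\<^sub>F n in sequentially. c1 * f n \<le> real (alpha m n) \<and> real (alpha m n) \<le> c2 * f n"
    \<comment> \<open>From 2 on, the half-length \<open>n div 2\<close> in the lower bound is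
      positive.\<close>
    using eventually_ge_at_top[of 2]
  proof eventually_elim
    case (elim n)
    then show ?case
      using alpha_ge[OF t d_def elim] alpha_le[OF t d_def, of n] f[of n] by (simp add: c1_def c2_def)
  qed
  have theta: "(\<lambda>n. real (alpha m n)) \<in> \<Theta>(f)"
  proof (rule bigthetaI)
    have nonneg: "0 \<le> f n" for n by (simp add: f_def)
    show "(\<lambda>n. real (alpha m n)) \<in> O(f)"
      by (rule bigoI[of _ c2], use ev in eventually_elim) (use nonneg in simp)
    show "(\<lambda>n. real (alpha m n)) \<in> \<Omega>(f)"
      using c by (intro landau_omega.bigI[of c1], simp, use ev in eventually_elim) (use nonneg in simp)
  qed
  let ?f = "\<lambda>n. real (alpha m 1) ^ n / real n powr (real ((m - 1) div 2) + 1 / 2)"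
  show "(\<lambda>n. real (alpha m n)) \<in> \<Theta>(?f)"
    by (fact theta[unfolded f_def])
  have "\<exists>c1 c2. 0 < c1 \<and> c1 \<le> c2 \<and>
      (\<forall>\<^sub>F n in sequentially. c1 * f n \<le> real (alpha m n) \<and> real (alpha m n) \<le> c2 * f n)"
    using c ev by (intro exI[of _ c1] exI[of _ c2]) auto
  then show "\<exists>c1 c2. 0 < c1 \<and> c1 \<le> c2 \<and>
      (\<forall>\<^sub>F n in sequentially. c1 * ?f n \<le> real (alpha m n) \<and> real (alpha m n) \<le> c2 * ?f n)"
    unfolding f_def .
qed (rule alpha_1; simp)+

end
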